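(* For a permutation $\sigma$ of $\{1,2,3,4\}$, the following are equivalent: (i) $\|z^\sigma\|_{\mathsf X}=\|z\|_{\mathsf X}$ for every $z\in\mathbb C^4$; (ii) $\|c^\sigma\|_{\mathsf X}'=\|c\|_{\mathsf X}'$ for every $c\in\mathbb C^4$; (iii) $|\phi_{z^\sigma}|=|\phi_z|$ for every $z\in\mathbb C^4$; (iv) $\sigma$ is one of the eight permutations $$\langle1234\rangle,\ \langle1324\rangle,\ \langle4231\rangle,\ \langle4321\rangle,\ \langle2143\rangle,\ \langle2413\rangle,\ \langle3142\rangle,\ \langle3412\rangle.$$
   Context: A permutation $\sigma$ of $\{1,2,3,4\}$ is written $\sigma=\langle\sigma(1)\sigma(2)\sigma(3)\sigma(4)\rangle$, and for $z\in\mathbb C^4$ put $z^\sigma=(z_{\sigma(1)},z_{\sigma(2)},z_{\sigma(3)},z_{\sigma(4)})$. On $\mathbb C^4$ define the norm $\|z\|_{\mathsf X}=\max_{\tau\in\mathbb R}\left(|z_1e^{\mathrm i\tau}+\bar z_4|+|z_2e^{\mathrm i\tau}+\bar z_3|\right)$ and its dual norm $\|c\|_{\mathsf X}'=\max\{|\langle c,z\rangle|:\|z\|_{\mathsf X}=1\}$, where $\langle c,z\rangle=\sum_{i=1}^4c_iz_i$ (bilinear). Writing $z_j=|z_j|e^{\mathrm i\theta_j}$, the phase difference of $z$ is $\phi_z=(\theta_1+\theta_4)-(\theta_2+\theta_3)$ mod $2\pi$, and $|\phi_z|$ is the absolute value of its representative in $(-\pi,\pi]$. (If some $z_j=0$,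 then $\theta_j$ is chosen arbitrarily and $z^\sigma$ is given the correspondingly permuted arguments.) *)

theory Defs
  imports "HOL-Analysis.Analysis" "HOL-Library.Real_Mod"
begin

text \<open>
  Indices range over the type \<open>4\<close>, whose four elements are \<open>1, 2, 3, 4\<close> (see \<open>UNIV_4\<close>; there
  \<open>4 = 0\<close>).  A permutation is a bijection \<open>4 \<Rightarrow> 4\<close>.
\<close>

definition permute_vec :: "(4 \<Rightarrow> 4) \<Rightarrow> 'a ^ 4 \<Rightarrow> 'a ^ 4" where
  "permute_vec \<sigma> z = (\<chi> i. z $ \<sigma> i)"

definition one_line :: "(4 \<Rightarrow> 4) \<Rightarrow> 4 list" where
  "one_line \<sigma> = [\<sigma> 1, \<sigma> 2, \<sigma> 3, \<sigma> 4]"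

definition X_fun :: "complex ^ 4 \<Rightarrow> real \<Rightarrow> real" where
  "X_fun z \<tau> = cmod (z $ 1 * cis \<tau> + cnj (z $ 4)) + cmod (z $ 2 * cis \<tau> + cnj (z $ 3))"

text \<open>The suprema in the two norms are maxima: see \<open>X_norm_attained\<close> and \<open>X_dual_norm_attained\<close>.\<close>

definition X_norm :: "complex ^ 4 \<Rightarrow> real" where
  "X_norm z = (SUP \<tau>. X_fun z \<tau>)"

definition pairing :: "complex ^ 4 \<Rightarrow> complex ^ 4 \<Rightarrow> complex" where
  "pairing c z = (\<Sum>i\<in>UNIV. c $ i * z $ i)"

definition X_dual_norm :: "complex ^ 4 \<Rightarrow> real" where
  "X_dual_norm c = (SUP z\<in>{z. X_norm z = 1}. cmod (pairing c z))"

text \<open>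
  \<open>args_of z \<theta>\<close> says that \<open>\<theta>\<close> is an admissible choice of arguments of the coordinates of \<open>z\<close>:
  \<open>\<theta> $ j\<close> is unconstrained where \<open>z $ j = 0\<close>.  Since the phase difference depends on that choice,
  it is a function of \<open>\<theta>\<close>.
\<close>

definition args_of :: "complex ^ 4 \<Rightarrow> real ^ 4 \<Rightarrow> bool" where
  "args_of z \<theta> \<longleftrightarrow> (\<forall>j. z $ j = rcis (cmod (z $ j)) (\<theta> $ j))"

definition phase_diff :: "real ^ 4 \<Rightarrow> real" where
  "phase_diff \<theta> = (THE \<phi>. \<phi> \<in> {-pi<..pi} \<and>
     [\<phi> = (\<theta> $ 1 + \<theta> $ 4) - (\<theta> $ 2 + \<theta> $ 3)] (rmod (2 * pi)))"

lemma phase_diff_ex1: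
  "\<exists>!\<phi>. \<phi> \<in> {-pi<..pi} \<and> [\<phi> = x] (rmod (2 * pi))"
proof -
  have "[\<phi> = x] (rmod (2 * pi)) \<longleftrightarrow> cis \<phi> = cis x" for \<phi>
    by (simp add: cis_eq_iff)
  moreover have "\<exists>!\<phi>. \<phi> \<in> {-pi<..pi} \<and> cis \<phi> = cis x"
  proof (rule ex1I[of _ "Arg (cis x)"])
    show "Arg (cis x) \<in> {-pi<..pi} \<and> cis (Arg (cis x)) = cis x"
      using Arg_bounded[of "cis x"] by (simp add: cis_Arg)
    show "\<phi> = Arg (cis x)" if "\<phi> \<in> {-pi<..pi} \<and> cis \<phi> = cis x" for \<phi>
      using that by (metis cis_Arg_unique greaterThanAtMost_iff sgn_cis)
  qed
  ultimately show ?thesis by simp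
qed

lemma X_norm_attained: "\<exists>\<tau>. X_norm z = X_fun z \<tau> \<and> (\<forall>\<tau>'. X_fun z \<tau>' \<le> X_norm z)"
proof -
  have "continuous_on {0..2*pi} (X_fun z)"
    unfolding X_fun_def cis_conv_exp by (intro continuous_intros)
  then obtain \<tau> where \<tau>: "\<And>t. t \<in> {0..2*pi} \<Longrightarrow> X_fun z t \<le> X_fun z \<tau>"
    using continuous_attains_sup[of "{0..2*pi}" "X_fun z"] by fastforce
  have le: "X_fun z t \<le> X_fun z \<tau>" for t
  proof -
    have "X_fun z t = X_fun z (t rmod (2*pi))"
      unfolding X_fun_def by (simp add: cis_eq_iff rcong_sym)
    moreover have "t rmod (2*pi) \<in> {0..2*pi}"
      by (simp add: rmod_nonneg rmod_le)
    ultimately show ?thesis using \<tau> by metis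
  qed
  then have "X_norm z = X_fun z \<tau>"
    unfolding X_norm_def by (intro cSup_eq_maximum) auto
  with le show ?thesis by auto
qed

lemma X_norm_triangle: "X_norm (z + w) \<le> X_norm z + X_norm w"
proof -
  obtain \<tau> where \<tau>: "X_norm (z + w) = X_fun (z + w) \<tau>" using X_norm_attained by blast
  have "X_fun (z + w) \<tau> \<le> X_fun z \<tau> + X_fun w \<tau>"
  proof -
    have "cmod ((a + b) * cis \<tau> + cnj (d + e)) \<le> cmod (a * cis \<tau> + cnj d) + cmod (b * cis \<tau> + cnj e)"
      for a b d e
      using norm_triangle_ineq[of "a * cis \<tau> + cnj d" "b * cis \<tau> + cnj e"]
      by (simp add: algebra_simps)
    from this[of "z $ 1" "w $ 1" "z $ 4" "w $ 4"] this[of "z $ 2" "w $ 2" "z $ 3" "w $ 3"]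
    show ?thesis unfolding X_fun_def by simp
  qed
  also have "\<dots> \<le> X_norm z + X_norm w" using X_norm_attained by (meson add_mono)
  finally show ?thesis using \<tau> by simp
qed

lemma X_norm_le: "X_norm z \<le> 4 * norm z"
proof -
  obtain \<tau> where \<tau>: "X_norm z = X_fun z \<tau>" using X_norm_attained by blast
  have "cmod (a * cis \<tau> + cnj b) \<le> cmod a + cmod b" for a b
    using norm_triangle_ineq[of "a * cis \<tau>" "cnj b"] by (simp add: norm_mult)
  from this[of "z $ 1" "z $ 4"] this[of "z $ 2" "z $ 3"]
  show ?thesis using \<tau> Finite_Cartesian_Product.norm_nth_le[of z 1] Finite_Cartesian_Product.norm_nth_le[of z 2]
      Finite_Cartesian_Product.norm_nth_le[of z 3] Finite_Cartesian_Product.norm_nth_le[of z 4]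
    unfolding X_fun_def by linarith
qed

lemma norm_le_X_norm: "norm z \<le> 4 * X_norm z"
proof -
  have *: "\<exists>\<tau>. cmod (a * cis \<tau> + cnj b) = cmod a + cmod b" for a b
  proof -
    have "a * cis (- Arg a - Arg b) + cnj b = of_real (cmod a + cmod b) * cis (- Arg b)"
    proof -
      have a: "a = of_real (cmod a) * cis (Arg a)" and b: "b = of_real (cmod b) * cis (Arg b)"
        by (metis rcis_cmod_Arg rcis_def)+
      have "a * cis (- Arg a - Arg b) = of_real (cmod a) * cis (- Arg b)"
        by (subst a) (simp add: mult.assoc cis_mult)
      moreover have "cnj b = of_real (cmod b) * cis (- Arg b)"
        by (subst b) (simp add: cis_cnj)
      ultimately show ?thesis by (simp add: distrib_right)
    qed
    then have "cmod (a * cis (- Arg a - Arg b) + cnj b) = cmod a + cmod b"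
      by (simp only: norm_mult norm_cis norm_of_real) simp
    then show ?thesis by blast
  qed
  have "cmod (z $ 1) + cmod (z $ 4) \<le> X_norm z" "cmod (z $ 2) + cmod (z $ 3) \<le> X_norm z"
    using *[of "z $ 1" "z $ 4"] *[of "z $ 2" "z $ 3"] X_norm_attained[of z]
    unfolding X_fun_def by (smt (verit) norm_ge_zero)+
  moreover have "norm z \<le> (\<Sum>i\<in>UNIV. cmod (z $ i))"
    by (simp add: norm_vec_def L2_set_le_sum)
  ultimately show ?thesis unfolding sum_4 by (smt (verit) norm_ge_zero)
qed

lemma X_norm_scaleR: 
  assumes "r \<ge> 0" shows "X_norm (r *\<^sub>R z) = r * X_norm z"
proof -
  have "X_fun (r *\<^sub>R z) \<tau> = r * X_fun z \<tau>" for \<tau>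
  proof -
    have "cmod (r *\<^sub>R a * cis \<tau> + cnj (r *\<^sub>R b)) = r * cmod (a * cis \<tau> + cnj b)" for a b
    proof -
      have "r *\<^sub>R a * cis \<tau> + cnj (r *\<^sub>R b) = r *\<^sub>R (a * cis \<tau> + cnj b)"
        by (simp add: scaleR_conv_of_real algebra_simps)
      then show ?thesis using assms by (metis abs_of_nonneg norm_scaleR)
    qed
    then show ?thesis unfolding X_fun_def by (simp only: vector_scaleR_component distrib_left)
  qed
  then show ?thesis
    using X_norm_attained[of z] X_norm_attained[of "r *\<^sub>R z"] assms
    by (metis antisym mult_left_mono)
qed

lemma X_dual_norm_attained:
  "\<exists>z. X_norm z = 1 \<and> X_dual_norm c = cmod (pairing c z)
     \<and> (\<forall>w. X_norm w = 1 \<longrightarrow> cmod (pairing c w) \<le> X_dual_norm c)"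
proof -
  let ?S = "{z. X_norm z = 1}"
  have "4-lipschitz_on UNIV X_norm"
  proof (rule lipschitz_onI)
    fix z w :: "complex ^ 4"
    show "dist (X_norm z) (X_norm w) \<le> 4 * dist z w"
      using X_norm_triangle[of w "z - w"] X_norm_triangle[of z "w - z"]
        X_norm_le[of "z - w"] X_norm_le[of "w - z"]
      by (simp add: dist_norm norm_minus_commute abs_le_iff)
  qed simp
  then have "continuous_on UNIV X_norm" by (rule lipschitz_on_continuous_on)
  then have "closed ?S" by (intro closed_Collect_eq) auto
  moreover have "bounded ?S"
    unfolding bounded_iff by (metis (mono_tags) mem_Collect_eq mult.right_neutral norm_le_X_norm)
  ultimately have "compact ?S" by (simp add: compact_eq_bounded_closed)
  moreover have "?S \<noteq> {}"
  proof -
    let ?u = "axis 1 1 :: complex ^ 4"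
    have "X_norm ?u > 0"
      using norm_le_X_norm[of ?u] by (smt (verit) axis_eq_0_iff zero_less_norm_iff zero_neq_one)
    then have "X_norm ((1 / X_norm ?u) *\<^sub>R ?u) = 1" by (subst X_norm_scaleR) auto
    then show ?thesis by blast
  qed
  moreover have "continuous_on ?S (\<lambda>z. cmod (pairing c z))"
    unfolding pairing_def by (intro continuous_intros)
  ultimately obtain z where z: "z \<in> ?S" "\<forall>w\<in>?S. cmod (pairing c w) \<le> cmod (pairing c z)"
    using continuous_attains_sup[of ?S "\<lambda>z. cmod (pairing c z)"] by blast
  then have "X_dual_norm c = cmod (pairing c z)"
    unfolding X_dual_norm_def by (intro cSup_eq_maximum) auto
  with z show ?thesis by auto
qed

end

theory Submission
  imports Defs
begin

text \<open>
  Both \<open>\<parallel>z\<parallel>\<^sub>X\<close> and \<open>\<bar>\<phi>\<^sub>z\<bar>\<close> depend only on the unordered partition of the coordinates into the pairs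
  \<open>{z\<^sub>1, z\<^sub>4}\<close> and \<open>{z\<^sub>2, z\<^sub>3}\<close>, and the eight permutations are exactly the ones preserving the
  partition \<open>{{1, 4}, {2, 3}}\<close>.  Any other permutation turns \<open>(1, i, i, 1)\<close>, of norm \<open>2\<surd>2\<close> and
  phase difference \<open>\<pi>\<close>, into a vector of norm \<open>4\<close> and phase difference \<open>0\<close>.
  The equivalence of the two norm conditions is duality: a norming functional of \<open>z\<close> can be
  written down at a maximising angle \<open>\<tau>\<close>.
\<close>

abbreviation (input) eight_perms :: "4 list set" where
  "eight_perms \<equiv> {[1,2,3,4], [1,3,2,4], [4,2,3,1], [4,3,2,1],
                   [2,1,4,3], [2,4,1,3], [3,1,4,2], [3,4,1,2]}"

text \<open>The image of \<open>{1,4}\<close> is either a block of the partition, which gives the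
  eight permutations, or has one index in each block, and then so does the image of
  \<open>{2,3}\<close>.\<close>

lemma one_line_cases [consumes 1, case_names eight mixed]:
  assumes "bij \<sigma>"
  obtains (eight) "one_line \<sigma> \<in> eight_perms"
  | (mixed) "\<sigma> 1 \<in> {1,4} \<longleftrightarrow> \<sigma> 4 \<in> {2,3}" "\<sigma> 2 \<in> {1,4} \<longleftrightarrow> \<sigma> 3 \<in> {2,3}" "one_line \<sigma> \<notin> eight_perms"
proof -
  have "inj \<sigma>" using assms bij_is_inj by blast
  then have d: "\<sigma> 1 \<noteq> \<sigma> 2" "\<sigma> 1 \<noteq> \<sigma> 3" "\<sigma> 1 \<noteq> \<sigma> 4" "\<sigma> 2 \<noteq> \<sigma> 3" "\<sigma> 2 \<noteq> \<sigma> 4" "\<sigma> 3 \<noteq> \<sigma> 4"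
    by (simp_all add: inj_eq)
  show ?thesis
    using d exhaust_4[of "\<sigma> 1"] exhaust_4[of "\<sigma> 2"] exhaust_4[of "\<sigma> 3"] exhaust_4[of "\<sigma> 4"]
      that unfolding one_line_def
    by (elim disjE) simp_all
qed

lemma permute_vec_nth [simp]: "permute_vec \<sigma> z $ i = z $ \<sigma> i"
  by (simp add: permute_vec_def)

lemma permute_vec_inv:
  assumes "bij \<sigma>"
  shows "permute_vec \<sigma> (permute_vec (inv \<sigma>) z) = z" "permute_vec (inv \<sigma>) (permute_vec \<sigma> z) = z"
  using assms by (simp_all add: vec_eq_iff bij_is_inj bij_is_surj surj_f_inv_f)

lemma pairing_permute_vec:
  assumes "bij \<sigma>"
  shows "pairing (permute_vec \<sigma> c) (permute_vec \<sigma> z) = pairing c z"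
  unfolding pairing_def permute_vec_nth
  using assms by (intro sum.reindex_bij_betw[of \<sigma> UNIV UNIV "\<lambda>i. c $ i * z $ i"])

text \<open>Conjugation followed by multiplication with the unit \<open>cis \<tau>\<close>
  interchanges \<open>a\<close> and \<open>b\<close>. This covers the swaps inside a pair;
  exchanging the two pairs only reorders the sum in \<open>X_fun\<close>.\<close>

lemma norm_cis_add_cnj_commute: "cmod (a * cis \<tau> + cnj b) = cmod (b * cis \<tau> + cnj a)"
proof -
  have "cis \<tau> * cnj (a * cis \<tau> + cnj b) = b * cis \<tau> + cnj a"
    by (simp add: algebra_simps cis_cnj flip: cis_inverse)
  then show ?thesis
    by (metis complex_mod_cnj mult_1 norm_cis norm_mult)
qed

lemma X_norm_permute_eight:
  assumes "one_line \<sigma> \<in> eight_perms"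
  shows "X_norm (permute_vec \<sigma> z) = X_norm z"
proof -
  have "X_fun (permute_vec \<sigma> z) \<tau> = X_fun z \<tau>" for \<tau>
    using assms norm_cis_add_cnj_commute[of "z $ 1" \<tau> "z $ 4"]
      norm_cis_add_cnj_commute[of "z $ 2" \<tau> "z $ 3"]
    by (auto simp: X_fun_def one_line_def)
  then show ?thesis by (simp add: X_norm_def)
qed

lemma X_norm_permute_mixed:
  assumes "\<sigma> 1 \<in> {1,4} \<longleftrightarrow> \<sigma> 4 \<in> {2,3}" "\<sigma> 2 \<in> {1,4} \<longleftrightarrow> \<sigma> 3 \<in> {2,3}"
  shows "\<exists>z. X_norm (permute_vec \<sigma> z) \<noteq> X_norm z"
proof
  let ?z = "\<chi> i. if i \<in> {1,4} then 1 else \<i>"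
  have other: "k \<in> {2,3} \<longleftrightarrow> k \<notin> {1,4}" for k :: 4
    using exhaust_4[of k] by auto
  \<comment> \<open>Each pair now holds one 1 and one \<open>\<i>\<close>. Since
    \<open>cis (-pi/2) = -\<i>\<close>, the two terms inside each modulus coincide, so each modulus
    is 2.\<close>
  have "X_fun (permute_vec \<sigma> ?z) (-pi/2) = 4"
    using assms unfolding other by (auto simp: X_fun_def cis_minus_pi_half)
  then have "4 \<le> X_norm (permute_vec \<sigma> ?z)"
    by (metis X_norm_attained)
  moreover have "X_norm ?z < 4"
  proof -
    obtain \<tau> where \<tau>: "X_norm ?z = X_fun ?z \<tau>"
      using X_norm_attained by blast
    have "cmod (\<i> * cis \<tau> - \<i>) = cmod (cis \<tau> - 1)"
      by (metis mult.right_neutral mult_1 norm_ii norm_mult right_diff_distrib)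
    then have X: "X_norm ?z = cmod (cis \<tau> + 1) + cmod (cis \<tau> - 1)"
      unfolding \<tau> X_fun_def by simp
    \<comment> \<open>The parallelogram law; the bound 8 then follows from
      \<open>(a + b)\<^sup>2 \<le> 2 * (a\<^sup>2 + b\<^sup>2)\<close>.\<close>
    have "(cmod (cis \<tau> + 1))\<^sup>2 + (cmod (cis \<tau> - 1))\<^sup>2 = 4"
      by (simp add: cmod_power2 power2_sum power2_diff) (simp flip: distrib_left)
    then have "(X_norm ?z)\<^sup>2 \<le> 8"
      unfolding X using sum_squares_ge_zero[of "cmod (cis \<tau> + 1) - cmod (cis \<tau> - 1)" 0]
      by (simp add: power2_eq_square algebra_simps)
    then show ?thesis
      using power_less_imp_less_base[of "X_norm ?z" 2 4] by simp
  qed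
  ultimately show "X_norm (permute_vec \<sigma> ?z) \<noteq> X_norm ?z" by simp
qed

text \<open>Composing \<open>arccos\<close> with \<open>cos\<close> reduces modulo
  \<open>2 * pi\<close> and forgets the sign at once. Swaps inside a pair keep the angle, and
  exchanging the pairs negates it.\<close>

lemma abs_phase_diff:
  "\<bar>phase_diff \<theta>\<bar> = arccos (cos ((\<theta> $ 1 + \<theta> $ 4) - (\<theta> $ 2 + \<theta> $ 3)))"
proof -
  let ?x = "(\<theta> $ 1 + \<theta> $ 4) - (\<theta> $ 2 + \<theta> $ 3)"
  have *: "phase_diff \<theta> \<in> {-pi<..pi} \<and> [phase_diff \<theta> = ?x] (rmod (2 * pi))"
    unfolding phase_diff_def by (rule theI'[OF phase_diff_ex1])
  then have "cos (phase_diff \<theta>) = cos ?x"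
    by (metis cis.simps(1) cis_eq_iff)
  then have "arccos (cos \<bar>phase_diff \<theta>\<bar>) = arccos (cos ?x)" by simp
  with * show ?thesis by (subst (asm) arccos_cos) auto
qed

lemma phase_diff_permute_eight:
  assumes "one_line \<sigma> \<in> eight_perms"
  shows "\<bar>phase_diff (permute_vec \<sigma> \<theta>)\<bar> = \<bar>phase_diff \<theta>\<bar>"
  using assms cos_minus[of "(\<theta> $ 1 + \<theta> $ 4) - (\<theta> $ 2 + \<theta> $ 3)"]
  by (auto simp: abs_phase_diff one_line_def add.commute)

text \<open>The pair sums of the arguments of \<open>(1, \<i>, \<i>, 1)\<close> are 0 and
  \<open>pi\<close>; a mixed permutation makes both equal to \<open>pi/2\<close>.\<close>

lemma phase_diff_permute_mixed:
  assumes "\<sigma> 1 \<in> {1,4} \<longleftrightarrow> \<sigma> 4 \<in> {2,3}" "\<sigma> 2 \<in> {1,4} \<longleftrightarrow> \<sigma> 3 \<in> {2,3}"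
  shows "\<exists>z \<theta>. args_of z \<theta> \<and> \<bar>phase_diff (permute_vec \<sigma> \<theta>)\<bar> \<noteq> \<bar>phase_diff \<theta>\<bar>"
proof (intro exI conjI)
  let ?\<theta> = "\<chi> i. if i \<in> {1,4} then 0 else pi/2"
  have other: "k \<in> {2,3} \<longleftrightarrow> k \<notin> {1,4}" for k :: 4
    using exhaust_4[of k] by auto
  show "args_of (\<chi> i. cis (?\<theta> $ i)) ?\<theta>"
    by (simp add: args_of_def rcis_def)
  have "\<bar>phase_diff (permute_vec \<sigma> ?\<theta>)\<bar> = 0"
    using assms unfolding other by (auto simp: abs_phase_diff)
  moreover have "\<bar>phase_diff ?\<theta>\<bar> = pi"
    by (simp add: abs_phase_diff)
  ultimately show "\<bar>phase_diff (permute_vec \<sigma> ?\<theta>)\<bar> \<noteq> \<bar>phase_diff ?\<theta>\<bar>" by simp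
qed

text \<open>Because one entry of each pair is conjugated, the factor amounts to shifting
  \<open>\<tau>\<close> by \<open>2 * \<alpha>\<close>, which the maximum does not see.\<close>

lemma X_norm_cis_scale: "X_norm (cis \<alpha> *s z) = X_norm z"
proof -
  have le: "X_norm (cis \<alpha> *s z) \<le> X_norm z" for \<alpha> z
  proof -
    obtain \<tau> where \<tau>: "X_norm (cis \<alpha> *s z) = X_fun (cis \<alpha> *s z) \<tau>"
      using X_norm_attained by blast
    have "cmod (cis \<alpha> * a * cis \<tau> + cnj (cis \<alpha> * b)) = cmod (a * cis (\<tau> + 2 * \<alpha>) + cnj b)" for a b
    proof -
      have "cis \<alpha> * a * cis \<tau> + cnj (cis \<alpha> * b) = cis (- \<alpha>) * (a * cis (\<tau> + 2 * \<alpha>) + cnj b)"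
        by (simp add: cis_cnj algebra_simps cis_mult)
      then show ?thesis by (simp add: norm_mult)
    qed
    then have "X_fun (cis \<alpha> *s z) \<tau> = X_fun z (\<tau> + 2 * \<alpha>)"
      by (simp add: X_fun_def)
    with \<tau> show ?thesis using X_norm_attained by metis
  qed
  have "cis (- \<alpha>) *s (cis \<alpha> *s z) = z"
    by (simp add: vector_smult_assoc cis_mult)
  then show ?thesis
    using le[of \<alpha> z] le[of "- \<alpha>" "cis \<alpha> *s z"] by simp
qed

lemma norm_pairing_le: "cmod (pairing c z) \<le> X_dual_norm c * X_norm z"
proof (cases "z = 0")
  case True
  then show ?thesis
    using X_norm_scaleR[of 0 0] by (simp add: pairing_def)
next
  case False
  then have pos: "X_norm z > 0"
    using norm_le_X_norm[of z] by (smt (verit) zero_less_norm_iff)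
  let ?w = "(1 / X_norm z) *\<^sub>R z"
  have "X_norm ?w = 1"
    using pos by (subst X_norm_scaleR) auto
  then have "cmod (pairing c ?w) \<le> X_dual_norm c"
    using X_dual_norm_attained by blast
  moreover have "pairing c ?w = (1 / X_norm z) *\<^sub>R pairing c z"
    by (simp add: pairing_def scaleR_sum_right)
  ultimately show ?thesis
    using pos by (simp add: field_simps)
qed

lemma X_norm_normed_by:
  obtains c where "X_dual_norm c \<le> 1" "cmod (pairing c z) = X_norm z"
proof -
  obtain \<tau> where \<tau>: "X_norm z = X_fun z \<tau>"
    using X_norm_attained by blast
  \<comment> \<open>The units \<open>u\<close> and \<open>v\<close> rotate the two terms of
    \<open>X_fun z \<tau>\<close> onto the nonnegative real axis.\<close>
  define u where "u = cis (- Arg (z $ 1 * cis \<tau> + cnj (z $ 4)))"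
  define v where "v = cis (- Arg (z $ 2 * cis \<tau> + cnj (z $ 3)))"
  \<comment> \<open>\<open>X_fun\<close> conjugates coordinates 3 and 4 but \<open>pairing\<close>
    is bilinear, so their coefficients are conjugated instead. This changes the pairing only in its
    imaginary part.\<close>
  define c :: "complex ^ 4" where
    "c = (\<chi> i. if i = 1 then u * cis \<tau> else if i = 2 then v * cis \<tau> else if i = 3 then cnj v else cnj u)"
  have Re_pairing: "Re (pairing c w) =
      Re (u * (w $ 1 * cis \<tau> + cnj (w $ 4)) + v * (w $ 2 * cis \<tau> + cnj (w $ 3)))" for w
    by (simp add: pairing_def c_def sum_4 algebra_simps)
  have Re_le: "Re (pairing c w) \<le> X_norm w" for w
  proof -
    have "Re (pairing c w) \<le> cmod (u * (w $ 1 * cis \<tau> + cnj (w $ 4)) + v * (w $ 2 * cis \<tau> + cnj (w $ 3)))"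
      unfolding Re_pairing by (rule complex_Re_le_cmod)
    also have "\<dots> \<le> X_fun w \<tau>"
      unfolding X_fun_def by (rule norm_triangle_le) (simp add: norm_mult u_def v_def)
    finally show ?thesis using X_norm_attained[of w] by (meson order_trans)
  qed
  have le: "cmod (pairing c w) \<le> X_norm w" for w
  proof -
    \<comment> \<open>Rotating \<open>w\<close> by this angle makes the pairing equal to its modulus
      and keeps \<open>X_norm\<close>, so the bound on real parts suffices.\<close>
    define \<alpha> where "\<alpha> = - Arg (pairing c w)"
    have "pairing c (cis \<alpha> *s w) = cis \<alpha> * pairing c w"
      by (simp add: pairing_def sum_distrib_left algebra_simps)
    also have "\<dots> = of_real (cmod (pairing c w))"
      by (subst (2) rcis_cmod_Arg[symmetric]) (simp add: \<alpha>_def rcis_def cis_mult)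
    finally show ?thesis
      using Re_le[of "cis \<alpha> *s w"] by (simp add: X_norm_cis_scale)
  qed
  have rotate: "cis (- Arg a) * a = of_real (cmod a)" for a
    by (subst (2) rcis_cmod_Arg[symmetric]) (simp add: rcis_def cis_mult)
  have "Re (pairing c z) = X_norm z"
    unfolding Re_pairing \<tau> X_fun_def u_def v_def rotate by simp
  then have "cmod (pairing c z) = X_norm z"
    using le[of z] complex_Re_le_cmod[of "pairing c z"] by simp
  moreover have "X_dual_norm c \<le> 1"
    using X_dual_norm_attained[of c] le by metis
  ultimately show ?thesis using that by blast
qed

text \<open>A maximiser for \<open>c\<close>, once permuted, is a unit vector with the same pairing
  against the permuted \<open>c\<close>.\<close>

lemma X_dual_norm_permute_le:
  assumes "bij \<sigma>" "\<And>z. X_norm (permute_vec \<sigma> z) = X_norm z"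
  shows "X_dual_norm c \<le> X_dual_norm (permute_vec \<sigma> c)"
proof -
  obtain z where "X_norm z = 1" "X_dual_norm c = cmod (pairing c z)"
    using X_dual_norm_attained by blast
  then show ?thesis
    using norm_pairing_le[of "permute_vec \<sigma> c" "permute_vec \<sigma> z"] assms
    by (simp add: pairing_permute_vec)
qed

text \<open>The same argument with the roles exchanged: a norming functional of \<open>z\<close>
  replaces the maximiser.\<close>

lemma X_norm_permute_le:
  assumes "bij \<sigma>" "\<And>c. X_dual_norm (permute_vec \<sigma> c) = X_dual_norm c"
  shows "X_norm z \<le> X_norm (permute_vec \<sigma> z)"
proof -
  obtain c where c: "X_dual_norm c \<le> 1" "cmod (pairing c z) = X_norm z"
    by (rule X_norm_normed_by)
  have "0 \<le> X_norm (permute_vec \<sigma> z)"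
    using norm_le_X_norm[of "permute_vec \<sigma> z"] by (smt (verit) norm_ge_zero)
  then have "X_dual_norm c * X_norm (permute_vec \<sigma> z) \<le> X_norm (permute_vec \<sigma> z)"
    using c(1) mult_right_mono[of "X_dual_norm c" 1] by simp
  then show ?thesis
    using norm_pairing_le[of "permute_vec \<sigma> c" "permute_vec \<sigma> z"] assms c(2)
    by (simp add: pairing_permute_vec)
qed

lemma X_norm_permute_iff_dual:
  assumes "bij \<sigma>"
  shows "(\<forall>z. X_norm (permute_vec \<sigma> z) = X_norm z)
     \<longleftrightarrow> (\<forall>c. X_dual_norm (permute_vec \<sigma> c) = X_dual_norm c)"
proof -
  have inv: "bij (inv \<sigma>)" using assms by (rule bij_imp_bij_inv)
  show ?thesis
  proof (intro iffI allI antisym)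
    fix c assume "\<forall>z. X_norm (permute_vec \<sigma> z) = X_norm z"
    \<comment> \<open>The inverse permutation inherits the invariance, so the one-sided lemma
      applied to \<open>inv \<sigma>\<close> gives the reverse inequality.\<close>
    then have N: "X_norm (permute_vec \<sigma> z) = X_norm z" "X_norm (permute_vec (inv \<sigma>) z) = X_norm z" for z
      by (simp, metis permute_vec_inv(1)[OF assms])
    show "X_dual_norm c \<le> X_dual_norm (permute_vec \<sigma> c)"
      by (rule X_dual_norm_permute_le[OF assms N(1)])
    show "X_dual_norm (permute_vec \<sigma> c) \<le> X_dual_norm c"
      using X_dual_norm_permute_le[OF inv N(2), of "permute_vec \<sigma> c"]
      by (simp add: permute_vec_inv(2)[OF assms])
  next
    fix z assume "\<forall>c. X_dual_norm (permute_vec \<sigma> c) = X_dual_norm c"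
    then have N: "X_dual_norm (permute_vec \<sigma> c) = X_dual_norm c"
        "X_dual_norm (permute_vec (inv \<sigma>) c) = X_dual_norm c" for c
      by (simp, metis permute_vec_inv(1)[OF assms])
    show "X_norm z \<le> X_norm (permute_vec \<sigma> z)"
      by (rule X_norm_permute_le[OF assms N(1)])
    show "X_norm (permute_vec \<sigma> z) \<le> X_norm z"
      using X_norm_permute_le[OF inv N(2), of "permute_vec \<sigma> z"]
      by (simp add: permute_vec_inv(2)[OF assms])
  qed
qed

theorem proposition3p5:
  fixes \<sigma> :: "4 \<Rightarrow> 4"
  assumes "bij \<sigma>"
  shows "((\<forall>z. X_norm (permute_vec \<sigma> z) = X_norm z)
            \<longleftrightarrow> (\<forall>c. X_dual_norm (permute_vec \<sigma> c) = X_dual_norm c))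
       \<and> ((\<forall>c. X_dual_norm (permute_vec \<sigma> c) = X_dual_norm c)
            \<longleftrightarrow> (\<forall>z \<theta>. args_of z \<theta> \<longrightarrow> \<bar>phase_diff (permute_vec \<sigma> \<theta>)\<bar> = \<bar>phase_diff \<theta>\<bar>))
       \<and> ((\<forall>z \<theta>. args_of z \<theta> \<longrightarrow> \<bar>phase_diff (permute_vec \<sigma> \<theta>)\<bar> = \<bar>phase_diff \<theta>\<bar>)
            \<longleftrightarrow> one_line \<sigma> \<in> {[1,2,3,4], [1,3,2,4], [4,2,3,1], [4,3,2,1],
                               [2,1,4,3], [2,4,1,3], [3,1,4,2], [3,4,1,2]})"
  using assms
\<comment> \<open>All four conditions hold in the first case and all fail in the second; duality
  settles the dual norm in both.\<close>
proof (cases rule: one_line_cases)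
  case eight
  then show ?thesis
    using X_norm_permute_iff_dual[OF assms] X_norm_permute_eight phase_diff_permute_eight by blast
next
  case mixed
  then show ?thesis
    using X_norm_permute_iff_dual[OF assms] X_norm_permute_mixed[of \<sigma>] phase_diff_permute_mixed[of \<sigma>]
    by blast
qed

end
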